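(* Let $p_1<p_2$ be finite real numbers, let $I\subset\mathbb{R}$ be an open interval containing $[p_1,p_2]$, and let $\mu\in(0,1]$. Let $U:(p_1,p_2]\to\mathbb{C}$ and suppose there is a function $\tilde u:[p_1,p_2]\to\mathbb{C}$, continuous on $[p_1,p_2]$, differentiable on $(p_1,p_2)$ with $\tilde u'\in L^1((p_1,p_2),\mathbb{C})$, and with $\tilde u(p_1)\neq 0$ if $\mu\neq 1$, such that $U(p)=(p-p_1)^{\mu-1}\,\tilde u(p)$ for all $p\in(p_1,p_2]$. Let $\psi:I\to\mathbb{R}$ belong to $\mathcal{C}^2(I)$ and suppose that $\psi'$ does not vanish on $[p_1,p_2]$ and is monotone on $[p_1,p_2]$. Then for all $\omega>0$, $$\left|\int_{p_1}^{p_2}U(p)\,e^{i\omega\psi(p)}\,dp\right|\leqslant C^c(U,\psi)\,\omega^{-\mu},$$ where $$C^c(U,\psi):=\frac{1}{\mu}\,\|\tilde u\|_{L^\infty(p_1,p_2)}+\Big(4\,\|\tilde u\|_{L^\infty(p_1,p_2)}+\|\tilde u'\|_{L^1(p_1,p_2)}\Big)\Big(\min_{p\in[p_1,p_2]}|\psi'(p)|\Big)^{-1}.$$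
   Context: All notation is standard. *)

theory Defs
  imports "HOL-Probability.Essential_Supremum"
begin

text \<open>On an open set \<open>S\<close>, the two-sided derivatives used here are the usual ones.\<close>

definition C2_differentiable_on :: "(real \<Rightarrow> real) \<Rightarrow> real set \<Rightarrow> bool"
    (infix \<open>C2'_differentiable'_on\<close> 50)
  where "f C2_differentiable_on S \<longleftrightarrow>
    f C1_differentiable_on S \<and> deriv f C1_differentiable_on S"

text \<open>The library's \<open>esssup\<close> is taken in \<open>ereal\<close> and is \<open>\<infinity>\<close> for essentially unbounded functions,
  which \<open>real_of_ereal\<close> would send to \<open>0\<close>. So this is the norm only for elements of
  \<open>L\<^sup>\<infinity>(S)\<close>, e.g. for functions continuous on a compact set containing \<open>S\<close>.\<close>

definition Linf_norm :: "real set \<Rightarrow> (real \<Rightarrow> complex) \<Rightarrow> real"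
  where "Linf_norm S f = real_of_ereal (esssup (lebesgue_on S) (\<lambda>p. ereal (norm (f p))))"

definition L1_norm :: "real set \<Rightarrow> (real \<Rightarrow> complex) \<Rightarrow> real"
  where "L1_norm S f = (LINT p:S|lebesgue. norm (f p))"

text \<open>The constant depends on \<open>U\<close> through its regular factor \<open>u\<close>, where
  \<open>U p = (p - p1) powr (\<mu> - 1) * u p\<close>. The infimum is a minimum whenever \<open>deriv \<psi>\<close> is
  continuous on \<open>{p1..p2}\<close>.\<close>

definition Cc :: "real \<Rightarrow> real \<Rightarrow> real \<Rightarrow> (real \<Rightarrow> complex) \<Rightarrow> (real \<Rightarrow> real) \<Rightarrow> real"
  where "Cc p1 p2 \<mu> u \<psi> =
    1 / \<mu> * Linf_norm {p1<..<p2} u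
    + (4 * Linf_norm {p1<..<p2} u
       + L1_norm {p1<..<p2} (\<lambda>p. vector_derivative u (at p)))
      * inverse (INF p\<in>{p1..p2}. \<bar>deriv \<psi> p\<bar>)"

end

theory Submission
  imports Defs
begin

text \<open>
  The singular amplitude has integral at most \<open>M / \<mu> * (q - p1) powr \<mu>\<close> over \<open>{p1<..q}\<close>, where
  \<open>M\<close> is the supremum of \<open>norm u\<close>. On \<open>{q..p2}\<close> one writes
  \<open>exp (\<i> \<omega> \<psi>) = (exp (\<i> \<omega> \<psi>))' / (\<i> \<omega> \<psi>')\<close> and integrates by parts. The two boundary terms, the
  derivative of the power and the derivative of \<open>1 / \<psi>'\<close> (of constant sign, as \<open>\<psi>'\<close> is monotone)
  contribute one \<open>M\<close> each, and the derivative of \<open>u\<close> contributes its \<open>L\<^sup>1\<close> norm, all multiplied by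
  \<open>(q - p1) powr (\<mu> - 1) / (\<omega> * min \<bar>\<psi>'\<bar>)\<close>. The choice \<open>q = p1 + 1 / \<omega>\<close>
  balances the two parts; if it exceeds \<open>p2\<close>, the first estimate alone suffices.
\<close>

section \<open>Integration by parts against an oscillating exponential\<close>

text \<open>By monotonicity \<open>f'\<close> has a constant sign, so up to that sign the integrand
  is the derivative of \<open>- 1 / f\<close> and the integral reduces to endpoint values. These
  have equal signs and size at most \<open>1 / m\<close>, so their difference is at most
  \<open>1 / m\<close>, not \<open>2 / m\<close>; this keeps the final constant at 4 rather than
  5.\<close>

lemma integral_abs_deriv_inverse_le:
  fixes f f' :: "real \<Rightarrow> real"
  assumes "a \<le> b" "0 < m"
    and cont: "continuous_on {a..b} f"
    and deriv: "\<And>x. x \<in> {a<..<b} \<Longrightarrow> (f has_real_derivative f' x) (at x)"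
    and lb: "\<And>x. x \<in> {a..b} \<Longrightarrow> m \<le> \<bar>f x\<bar>"
    and mono: "mono_on {a..b} f \<or> antimono_on {a..b} f"
  shows "(\<lambda>x. \<bar>f' x\<bar> / (f x)\<^sup>2) integrable_on {a..b}"
    and "integral {a..b} (\<lambda>x. \<bar>f' x\<bar> / (f x)\<^sup>2) \<le> 1 / m"
proof -
  have nz: "f x \<noteq> 0" if "x \<in> {a..b}" for x
    using lb[OF that] \<open>0 < m\<close> by auto
  \<comment> \<open>The sign \<open>t\<close> is 1 in the increasing and -1 in the decreasing case,
    so both share one computation.\<close>
  obtain t :: real where t: "\<bar>t\<bar> = 1" "\<And>x. x \<in> {a<..<b} \<Longrightarrow> \<bar>f' x\<bar> = t * f' x"
    using mono
  proof
    assume "mono_on {a..b} f"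
    then have "f' x \<ge> 0" if "x \<in> {a<..<b}" for x
      using mono_on_imp_deriv_nonneg[of "{a..b}" f "f' x" x] deriv that by simp
    then show thesis using that[of 1] by auto
  next
    assume "antimono_on {a..b} f"
    then have "mono_on {a..b} (\<lambda>x. - f x)"
      by (auto simp: monotone_on_def)
    then have "- f' x \<ge> 0" if "x \<in> {a<..<b}" for x
      using mono_on_imp_deriv_nonneg[of "{a..b}" "\<lambda>x. - f x" "- f' x" x] deriv that
      by (simp add: DERIV_minus)
    then show thesis using that[of "-1"] by force
  qed
  \<comment> \<open>The primitive is continuous up to the endpoints, so derivatives inside suffice,
    and integrability comes with the value.\<close>
  have "((\<lambda>x. t * f' x / (f x)\<^sup>2) has_integral (- t / f b - (- t / f a))) {a..b}"
  proof (rule fundamental_theorem_of_calculus_interior)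
    show "continuous_on {a..b} (\<lambda>x. - t / f x)"
      using nz by (intro continuous_intros cont) auto
    show "((\<lambda>x. - t / f x) has_vector_derivative t * f' x / (f x)\<^sup>2) (at x)"
      if "x \<in> {a<..<b}" for x
      unfolding has_real_derivative_iff_has_vector_derivative [symmetric]
      using deriv[OF that] nz[of x] that
      by (auto intro!: derivative_eq_intros simp: power2_eq_square)
  qed fact
  then have int: "((\<lambda>x. \<bar>f' x\<bar> / (f x)\<^sup>2) has_integral (- t / f b - (- t / f a))) {a..b}"
    unfolding has_integral_Icc_iff_Ioo by (rule has_integral_eq[rotated]) (simp add: t)
  then show "(\<lambda>x. \<bar>f' x\<bar> / (f x)\<^sup>2) integrable_on {a..b}"
    by blast
  \<comment> \<open>A change of sign would force a zero of \<open>f\<close>, contradicting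
    \<open>m \<le> \<bar>f x\<bar>\<close>.\<close>
  have same_sign: "f a > 0 \<longleftrightarrow> f b > 0"
  proof (rule ccontr)
    assume "\<not> ?thesis"
    then consider "f a \<le> 0" "0 \<le> f b" | "0 \<le> f a" "f b \<le> 0" by linarith
    then have "\<exists>x\<ge>a. x \<le> b \<and> f x = 0"
      using IVT'[of f a 0 b, OF _ _ \<open>a \<le> b\<close> cont] IVT2'[of f b 0 a, OF _ _ \<open>a \<le> b\<close> cont]
      by cases blast+
    then show False using nz by auto
  qed
  have "- t / f b - (- t / f a) = t * (1 / f a - 1 / f b)"
    by (simp add: algebra_simps)
  also have "\<dots> \<le> \<bar>1 / f a - 1 / f b\<bar>"
    using t(1) by (metis abs_ge_self abs_mult mult_1)
  also have "\<dots> \<le> 1 / m"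
  proof -
    have bd: "\<bar>1 / f x\<bar> \<le> 1 / m" if "x \<in> {a..b}" for x
      using lb[OF that] \<open>0 < m\<close> by (simp add: frac_le)
    have "0 < 1 / f a \<longleftrightarrow> 0 < 1 / f b"
      using same_sign by simp
    moreover have "\<bar>x - y\<bar> \<le> c"
      if "\<bar>x\<bar> \<le> c" "\<bar>y\<bar> \<le> c" "0 < x \<longleftrightarrow> 0 < y" for x y c :: real
      using that by auto
    ultimately show ?thesis
      using bd[of a] bd[of b] \<open>a \<le> b\<close> by (metis atLeastAtMost_iff order_refl)
  qed
  finally show "integral {a..b} (\<lambda>x. \<bar>f' x\<bar> / (f x)\<^sup>2) \<le> 1 / m"
    using int by (simp add: integral_unique)
qed

text \<open>One \<open>K\<close> comes from each endpoint and one from the derivative of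
  \<open>1 / f'\<close>. The derivative of the amplitude enters through a majorant \<open>g\<close>,
  which the caller can choose with an explicit integral.\<close>

lemma oscillatory_integral_first_derivative_bound:
  fixes A A' :: "real \<Rightarrow> complex" and f f' f'' g :: "real \<Rightarrow> real"
  assumes "a \<le> b" "0 < m" "0 < \<omega>"
    and contA: "continuous_on {a..b} A"
    and derivA: "\<And>x. x \<in> {a<..<b} \<Longrightarrow> (A has_vector_derivative A' x) (at x)"
    and A_le: "\<And>x. x \<in> {a..b} \<Longrightarrow> norm (A x) \<le> K"
    and A'_le: "\<And>x. x \<in> {a<..<b} \<Longrightarrow> norm (A' x) \<le> g x"
    and g: "g integrable_on {a..b}"
    and contf: "continuous_on {a..b} f"
    and derivf: "\<And>x. x \<in> {a<..<b} \<Longrightarrow> (f has_real_derivative f' x) (at x)"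
    and contf': "continuous_on {a..b} f'"
    and derivf': "\<And>x. x \<in> {a<..<b} \<Longrightarrow> (f' has_real_derivative f'' x) (at x)"
    and lb: "\<And>x. x \<in> {a..b} \<Longrightarrow> m \<le> \<bar>f' x\<bar>"
    and mono: "mono_on {a..b} f' \<or> antimono_on {a..b} f'"
  shows "norm (integral {a..b} (\<lambda>x. A x * exp (\<i> * complex_of_real \<omega> * complex_of_real (f x))))
    \<le> (3 * K + integral {a..b} g) / (m * \<omega>)"
proof -
  define E where "E = (\<lambda>x. exp (\<i> * complex_of_real \<omega> * complex_of_real (f x)))"
  \<comment> \<open>Here \<open>E\<close> equals its own derivative times \<open>R * c\<close>.
    Hence \<open>F\<close> is the boundary term of the integration by parts, and \<open>H\<close>
    collects what arises when the derivative falls on \<open>A\<close> or \<open>R\<close>.\<close>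
  define c where "c = 1 / (\<i> * complex_of_real \<omega>)"
  define R where "R = (\<lambda>x. complex_of_real (1 / f' x))"
  define R' where "R' = (\<lambda>x. complex_of_real (- f'' x / (f' x)\<^sup>2))"
  define F where "F = (\<lambda>x. A x * E x * R x * c)"
  define H where "H = (\<lambda>x. A' x * E x * R x * c + A x * E x * R' x * c)"
  have normE [simp]: "norm (E x) = 1" for x
    by (simp add: E_def mult.assoc flip: of_real_mult)
  have normc: "norm c = 1 / \<omega>"
    using \<open>0 < \<omega>\<close> by (simp add: c_def norm_divide norm_mult)
  have nz: "f' x \<noteq> 0" if "x \<in> {a..b}" for x
    using lb[OF that] \<open>0 < m\<close> by auto
  have normR: "norm (R x) \<le> 1 / m" if "x \<in> {a..b}" for x
    using lb[OF that] \<open>0 < m\<close> by (simp add: R_def norm_divide frac_le)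
  have contE: "continuous_on {a..b} E"
    unfolding E_def by (intro continuous_intros contf)
  have contR: "continuous_on {a..b} R"
    unfolding R_def using nz by (intro continuous_intros contf') auto
  have derivE: "(E has_vector_derivative \<i> * of_real \<omega> * of_real (f' x) * E x) (at x)"
    if "x \<in> {a<..<b}" for x
  proof -
    have "((\<lambda>x. complex_of_real (f x)) has_vector_derivative of_real (f' x)) (at x)"
      using derivf[OF that] by (rule has_vector_derivative_of_real)
    then have "((\<lambda>x. \<i> * of_real \<omega> * complex_of_real (f x)) has_vector_derivative
        \<i> * of_real \<omega> * of_real (f' x)) (at x)"
      by (rule has_vector_derivative_mult_right)
    from field_vector_diff_chain_at[OF this DERIV_exp] show ?thesis
      by (simp add: E_def o_def)
  qed
  have derivR: "(R has_vector_derivative R' x) (at x)" if "x \<in> {a<..<b}" for x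
    unfolding R_def R'_def
    by (rule has_vector_derivative_of_real)
      (use derivf'[OF that] nz[of x] that in
        \<open>auto intro!: derivative_eq_intros simp: power2_eq_square\<close>)
  have derivF: "(F has_vector_derivative A x * E x + H x) (at x)" if "x \<in> {a<..<b}" for x
  proof -
    \<comment> \<open>The factor produced by differentiating \<open>E\<close> cancels
      \<open>R * c\<close>, which returns the original integrand \<open>A * E\<close>.\<close>
    have "\<i> * of_real \<omega> * of_real (f' x) * R x * c = 1"
      using nz[of x] that \<open>0 < \<omega>\<close> by (simp add: R_def c_def)
    then have "A x * E x = A x * (\<i> * of_real \<omega> * of_real (f' x) * E x) * R x * c"
      by (metis (no_types, opaque_lifting) mult.assoc mult.commute mult.right_neutral)
    then have eq: "A x * E x + H x =
      ((A x * E x) * R' x + (A x * (\<i> * of_real \<omega> * of_real (f' x) * E x) + A' x * E x) * R x) * c"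
      by (simp add: H_def algebra_simps)
    show ?thesis
      unfolding eq F_def using that
      by (intro has_vector_derivative_mult_left has_vector_derivative_mult derivA derivE derivR)
  qed
  have AE: "(\<lambda>x. A x * E x) integrable_on {a..b}"
    by (intro integrable_continuous_interval continuous_intros contA contE)
  have "((\<lambda>x. A x * E x + H x) has_integral (F b - F a)) {a..b}"
    by (rule fundamental_theorem_of_calculus_interior)
      (use \<open>a \<le> b\<close> derivF in \<open>auto simp: F_def intro!: continuous_intros contA contE contR\<close>)
  \<comment> \<open>Neither \<open>A'\<close> nor \<open>f''\<close> is assumed continuous;
    \<open>H\<close> is integrable because it is the derivative of \<open>F\<close> minus the
    continuous function \<open>A * E\<close>.\<close>
  from has_integral_diff[OF this integrable_integral[OF AE]]
  have H: "(H has_integral (F b - F a - integral {a..b} (\<lambda>x. A x * E x))) {a..b}"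
    by simp
  have K: "0 \<le> K" using order_trans[OF norm_ge_zero A_le[of a]] \<open>a \<le> b\<close> by simp
  have F_le: "norm (F x) \<le> K / (m * \<omega>)" if "x \<in> {a..b}" for x
  proof -
    have "norm (F x) = norm (A x) * norm (R x) * (1 / \<omega>)"
      by (simp add: F_def norm_mult normc)
    also have "\<dots> \<le> K * (1 / m) * (1 / \<omega>)"
      using A_le[OF that] normR[OF that] K \<open>0 < \<omega>\<close> \<open>0 < m\<close> by (intro mult_mono) auto
    finally show ?thesis by simp
  qed
  define G where "G = (\<lambda>x. (1 / (m * \<omega>)) * g x + (K / \<omega>) * (\<bar>f'' x\<bar> / (f' x)\<^sup>2))"
  note J = integral_abs_deriv_inverse_le[OF \<open>a \<le> b\<close> \<open>0 < m\<close> contf' derivf' lb mono]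
  have G: "(G has_integral ((1 / (m * \<omega>)) * integral {a..b} g
      + (K / \<omega>) * integral {a..b} (\<lambda>x. \<bar>f'' x\<bar> / (f' x)\<^sup>2))) {a..b}"
    unfolding G_def using g J(1)
    by (intro has_integral_add has_integral_mult_right integrable_integral)
  have H_le: "norm (H x) \<le> G x" if x: "x \<in> {a<..<b}" for x
  proof -
    have x': "x \<in> {a..b}" using x by auto
    have "norm (H x) \<le> norm (A' x) * norm (R x) * norm c + norm (A x) * norm (R' x) * norm c"
      unfolding H_def by (rule norm_triangle_le) (simp add: norm_mult)
    also have "\<dots> \<le> g x * (1 / m) * (1 / \<omega>) + K * (\<bar>f'' x\<bar> / (f' x)\<^sup>2) * (1 / \<omega>)"
      using A'_le[OF x] A_le[OF x'] normR[OF x'] K \<open>0 < \<omega>\<close> \<open>0 < m\<close> order_trans[OF norm_ge_zero A'_le[OF x]]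
      unfolding normc
      by (intro add_mono mult_mono) (auto simp: R'_def norm_divide norm_power)
    finally show ?thesis by (simp add: G_def mult.commute)
  qed
  have "norm (F b - F a - integral {a..b} (\<lambda>x. A x * E x)) \<le>
      (1 / (m * \<omega>)) * integral {a..b} g
      + (K / \<omega>) * integral {a..b} (\<lambda>x. \<bar>f'' x\<bar> / (f' x)\<^sup>2)"
  proof -
    \<comment> \<open>The pointwise bound \<open>H_le\<close> holds at interior points, and removing
      the endpoints changes neither integral.\<close>
    have H': "(H has_integral (F b - F a - integral {a..b} (\<lambda>x. A x * E x))) {a<..<b}"
      using H has_integral_Icc_iff_Ioo by blast
    have G': "(G has_integral ((1 / (m * \<omega>)) * integral {a..b} g
      + (K / \<omega>) * integral {a..b} (\<lambda>x. \<bar>f'' x\<bar> / (f' x)\<^sup>2))) {a<..<b}"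
      using G has_integral_Icc_iff_Ioo by blast
    show ?thesis
      using integral_norm_bound_integral[of H "{a<..<b}" G] H' G' H_le
      by (simp add: has_integral_iff)
  qed
  also have "\<dots> \<le> (1 / (m * \<omega>)) * integral {a..b} g + (K / \<omega>) * (1 / m)"
    using J(2) K \<open>0 < \<omega>\<close> by (intro add_left_mono mult_left_mono) auto
  finally have le: "norm (F b - F a - integral {a..b} (\<lambda>x. A x * E x)) \<le> \<dots>" .
  have "norm z \<le> norm x + norm y + norm (x - y - z)" for x y z :: complex
    by norm
  then have "norm (integral {a..b} (\<lambda>x. A x * E x)) \<le>
      norm (F b) + norm (F a) + norm (F b - F a - integral {a..b} (\<lambda>x. A x * E x))" .
  also have "\<dots> \<le> K / (m * \<omega>) + K / (m * \<omega>)
      + ((1 / (m * \<omega>)) * integral {a..b} g + (K / \<omega>) * (1 / m))"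
    using F_le[of a] F_le[of b] \<open>a \<le> b\<close> le by (intro add_mono) auto
  also have "\<dots> = (3 * K + integral {a..b} g) / (m * \<omega>)"
    by (simp add: add_divide_distrib mult.commute)
  finally show ?thesis
    by (simp add: E_def)
qed

section \<open>Essential supremum of a continuous function\<close>

text \<open>If the norm exceeded the essential supremum at an interior point, it would do so on a
  nonempty open set, which is not negligible. The endpoints follow by continuity.\<close>

lemma norm_le_Linf_norm:
  assumes "a < b" and cont: "continuous_on {a..b} f" and "x \<in> {a..b}"
  shows "norm (f x) \<le> Linf_norm {a<..<b} f"
proof -
  let ?M = "lebesgue_on {a<..<b}"
  define s where "s = esssup ?M (\<lambda>p. ereal (norm (f p)))"
  have contN: "continuous_on {a..b} (\<lambda>p. norm (f p))"
    by (intro continuous_intros cont)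
  then have contN': "continuous_on {a<..<b} (\<lambda>p. norm (f p))"
    by (rule continuous_on_subset) auto
  have meas: "(\<lambda>p. ereal (norm (f p))) \<in> borel_measurable ?M"
    using continuous_imp_measurable_on_sets_lebesgue[OF contN'] by simp
  have "compact ((\<lambda>p. norm (f p)) ` {a..b})"
    using contN by (intro compact_continuous_image) auto
  then obtain B where B: "\<And>p. p \<in> {a..b} \<Longrightarrow> norm (f p) \<le> B"
    by (meson bdd_above.E bounded_imp_bdd_above compact_imp_bounded image_eqI)
  \<comment> \<open>With the lower bound 0 found below, this makes \<open>s\<close> a real number,
    so \<open>real_of_ereal\<close> in \<open>Linf_norm\<close> does not fall back to its default
    0.\<close>
  have "s \<le> ereal B"
    unfolding s_def using meas B by (intro esssup_I) auto
  have le_s: "ereal (norm (f p)) \<le> s" if p: "p \<in> {a<..<b}" for p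
  proof (rule ccontr)
    assume "\<not> ?thesis"
    then have less: "s < ereal (norm (f p))" by simp
    define V where "V = {a<..<b} \<inter> (\<lambda>q. ereal (norm (f q))) -` {s<..}"
    have "open V"
      unfolding V_def
      by (intro continuous_open_preimage continuous_on_ereal contN') auto
    moreover have "p \<in> V" using p less by (simp add: V_def)
    moreover have "negligible V"
    proof -
      have "AE q in ?M. ereal (norm (f q)) \<le> s"
        unfolding s_def by (rule esssup_AE)
      then have "AE q in lebesgue. q \<in> {a<..<b} \<longrightarrow> ereal (norm (f q)) \<le> s"
        by (subst (asm) AE_restrict_space_iff) auto
      then obtain N where N: "N \<in> null_sets lebesgue"
        "{q. \<not> (q \<in> {a<..<b} \<longrightarrow> ereal (norm (f q)) \<le> s)} \<subseteq> N"
        by (auto simp: eventually_ae_filter)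
      then have "V \<subseteq> N" by (auto simp: V_def)
      then show ?thesis
        using N(1) negligible_iff_null_sets negligible_subset by blast
    qed
    ultimately show False
      using open_not_negligible by blast
  qed
  have "0 \<le> ereal (norm (f ((a + b) / 2)))" by simp
  also have "\<dots> \<le> s"
    using le_s \<open>a < b\<close> by simp
  finally have "0 \<le> s" .
  with \<open>s \<le> ereal B\<close> obtain r where r: "s = ereal r"
    by (cases s) auto
  then have le: "norm (f p) \<le> r" if "p \<in> {a<..<b}" for p
    using le_s[OF that] by simp
  have "norm (f x) \<le> r"
    using continuous_le_on_closure[of "{a<..<b}" "\<lambda>p. norm (f p)" x r] contN \<open>a < b\<close> \<open>x \<in> {a..b}\<close> le
    by simp
  then show ?thesis
    by (simp add: Linf_norm_def r flip: s_def)
qed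

section \<open>Power weights: the singular end and the oscillatory tail\<close>

text \<open>The disjunction covers two uses: exponent \<open>\<mu>\<close> from the singular point
  itself, and exponent \<open>\<mu> - 1\<close> away from it. Keeping the factor
  \<open>\<alpha>\<close> inside the integrand includes the case \<open>\<alpha> = 0\<close>, that
  is \<open>\<mu> = 1\<close>.\<close>

lemma has_integral_powr_shift:
  fixes a c d \<alpha> :: real
  assumes "a \<le> c" "c \<le> d" "0 < \<alpha> \<or> a < c"
  shows "((\<lambda>x. \<alpha> * (x - a) powr (\<alpha> - 1)) has_integral (d - a) powr \<alpha> - (c - a) powr \<alpha>) {c..d}"
proof (rule fundamental_theorem_of_calculus_interior)
  show "continuous_on {c..d} (\<lambda>x. (x - a) powr \<alpha>)"
    using assms by (intro continuous_on_powr' continuous_intros) auto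
  show "((\<lambda>x. (x - a) powr \<alpha>) has_vector_derivative \<alpha> * (x - a) powr (\<alpha> - 1)) (at x)"
    if "x \<in> {c<..<d}" for x
    unfolding has_real_derivative_iff_has_vector_derivative [symmetric]
    using that assms by (auto intro!: derivative_eq_intros)
qed fact

lemma powr_singular_integral_bound:
  fixes h :: "real \<Rightarrow> complex"
  assumes "a \<le> b" "0 < \<mu>"
    and cont: "continuous_on {a..b} h"
    and h_le: "\<And>x. x \<in> {a..b} \<Longrightarrow> norm (h x) \<le> K"
  shows "(\<lambda>x. complex_of_real ((x - a) powr (\<mu> - 1)) * h x) absolutely_integrable_on {a<..b}"
    and "norm (integral {a<..b} (\<lambda>x. complex_of_real ((x - a) powr (\<mu> - 1)) * h x))
      \<le> 1 / \<mu> * K * (b - a) powr \<mu>"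
proof -
  let ?f = "\<lambda>x. complex_of_real ((x - a) powr (\<mu> - 1)) * h x"
  let ?g = "\<lambda>x. K / \<mu> * (\<mu> * (x - a) powr (\<mu> - 1))"
  have "(?g has_integral K / \<mu> * ((b - a) powr \<mu> - (a - a) powr \<mu>)) {a..b}"
    by (intro has_integral_mult_right has_integral_powr_shift) (use assms in auto)
  then have "(?g has_integral K / \<mu> * (b - a) powr \<mu>) {a<..<b}"
    by (simp add: has_integral_Icc_iff_Ioo)
  then have g: "(?g has_integral K / \<mu> * (b - a) powr \<mu>) {a<..b}"
    by (rule has_integral_spike_set_eq[THEN iffD1, rotated 2])
      (auto intro: negligible_subset[of "{b}"])
  have le: "norm (?f x) \<le> ?g x" if "x \<in> {a<..b}" for x
    using mult_right_mono[OF h_le[of x], of "(x - a) powr (\<mu> - 1)"] that \<open>0 < \<mu>\<close>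
    by (simp add: norm_mult mult.commute)
  have "continuous_on {a<..b} h"
    using cont by (rule continuous_on_subset) auto
  then have "continuous_on {a<..b} ?f"
    by (intro continuous_intros continuous_on_powr') auto
  \<comment> \<open>Off the singular point the integrand is continuous, hence measurable, and
    \<open>?g\<close> is an integrable majorant.\<close>
  then show f: "?f absolutely_integrable_on {a<..b}"
    using g le
    by (intro measurable_bounded_by_integrable_imp_absolutely_integrable[of _ _ ?g]
        continuous_imp_measurable_on_sets_lebesgue) auto
  have "norm (integral {a<..b} ?f) \<le> integral {a<..b} ?g"
    by (rule integral_norm_bound_integral)
      (use set_lebesgue_integral_eq_integral(1)[OF f] g le in \<open>blast+\<close>)
  also have "\<dots> = 1 / \<mu> * K * (b - a) powr \<mu>"
    using g by (simp add: integral_unique)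
  finally show "norm (integral {a<..b} ?f) \<le> 1 / \<mu> * K * (b - a) powr \<mu>" .
qed

text \<open>On \<open>{q..b}\<close> the weight is positive and nonincreasing, so both its maximum
  and its total variation are at most its value at \<open>q\<close>. The variation supplies the
  fourth \<open>M\<close>, added to the three from integration by parts.\<close>

lemma powr_singular_oscillatory_tail_bound:
  fixes u u' :: "real \<Rightarrow> complex" and f f' f'' :: "real \<Rightarrow> real"
  assumes "a < q" "q \<le> b" "\<mu> \<le> 1" "0 < m" "0 < \<omega>"
    and contu: "continuous_on {q..b} u"
    and derivu: "\<And>x. x \<in> {q<..<b} \<Longrightarrow> (u has_vector_derivative u' x) (at x)"
    and u_le: "\<And>x. x \<in> {q..b} \<Longrightarrow> norm (u x) \<le> M"
    and u': "(\<lambda>x. norm (u' x)) integrable_on {q..b}" "integral {q..b} (\<lambda>x. norm (u' x)) \<le> V"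
    and contf: "continuous_on {q..b} f"
    and derivf: "\<And>x. x \<in> {q<..<b} \<Longrightarrow> (f has_real_derivative f' x) (at x)"
    and contf': "continuous_on {q..b} f'"
    and derivf': "\<And>x. x \<in> {q<..<b} \<Longrightarrow> (f' has_real_derivative f'' x) (at x)"
    and lb: "\<And>x. x \<in> {q..b} \<Longrightarrow> m \<le> \<bar>f' x\<bar>"
    and mono: "mono_on {q..b} f' \<or> antimono_on {q..b} f'"
  shows "norm (integral {q..b} (\<lambda>x. complex_of_real ((x - a) powr (\<mu> - 1)) * u x
      * exp (\<i> * complex_of_real \<omega> * complex_of_real (f x))))
    \<le> (4 * M + V) * (q - a) powr (\<mu> - 1) / (m * \<omega>)"
proof -
  define d where "d = (q - a) powr (\<mu> - 1)"
  define A where "A = (\<lambda>x. complex_of_real ((x - a) powr (\<mu> - 1)) * u x)"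
  define A' where "A' = (\<lambda>x. complex_of_real ((x - a) powr (\<mu> - 1)) * u' x
    + complex_of_real ((\<mu> - 1) * (x - a) powr (\<mu> - 1 - 1)) * u x)"
  \<comment> \<open>The second summand is \<open>- M\<close> times the derivative of the weight. It
    is nonnegative for \<open>\<mu> \<le> 1\<close> and has an explicit integral.\<close>
  define g where "g = (\<lambda>x. d * norm (u' x) + (- M) * ((\<mu> - 1) * (x - a) powr (\<mu> - 1 - 1)))"
  have "0 \<le> M"
    using order_trans[OF norm_ge_zero u_le[of q]] \<open>q \<le> b\<close> by simp
  have powr_le: "(x - a) powr (\<mu> - 1) \<le> d" if "q \<le> x" for x
    unfolding d_def using that \<open>a < q\<close> \<open>\<mu> \<le> 1\<close> by (intro powr_mono2') auto
  have g: "(g has_integral d * integral {q..b} (\<lambda>x. norm (u' x))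
      + (- M) * ((b - a) powr (\<mu> - 1) - d)) {q..b}"
    unfolding g_def d_def using assms
    by (intro has_integral_add has_integral_mult_right has_integral_powr_shift integrable_integral) auto
  have "norm (integral {q..b} (\<lambda>x. A x * exp (\<i> * complex_of_real \<omega> * complex_of_real (f x))))
    \<le> (3 * (d * M) + integral {q..b} g) / (m * \<omega>)"
  proof (rule oscillatory_integral_first_derivative_bound)
    show "continuous_on {q..b} A"
      unfolding A_def using \<open>a < q\<close> by (intro continuous_intros contu) auto
    show "(A has_vector_derivative A' x) (at x)" if "x \<in> {q<..<b}" for x
      unfolding A_def A'_def
    proof (intro has_vector_derivative_mult derivu[OF that] has_vector_derivative_of_real)
      show "((\<lambda>x. (x - a) powr (\<mu> - 1)) has_real_derivative (\<mu> - 1) * (x - a) powr (\<mu> - 1 - 1)) (at x)"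
        using that \<open>a < q\<close> by (auto intro!: derivative_eq_intros)
    qed
    show "norm (A x) \<le> d * M" if "x \<in> {q..b}" for x
      using mult_mono[OF powr_le[of x] u_le[OF that]] that by (simp add: A_def norm_mult d_def)
    show "norm (A' x) \<le> g x" if "x \<in> {q<..<b}" for x
    proof -
      have "norm (A' x) \<le> (x - a) powr (\<mu> - 1) * norm (u' x)
          + (1 - \<mu>) * (x - a) powr (\<mu> - 1 - 1) * norm (u x)"
        unfolding A'_def using \<open>\<mu> \<le> 1\<close>
        by (intro norm_triangle_le) (simp add: norm_mult abs_mult del: of_real_diff of_real_mult)
      also have "\<dots> \<le> d * norm (u' x) + (1 - \<mu>) * (x - a) powr (\<mu> - 1 - 1) * M"
        using that powr_le[of x] u_le[of x] \<open>\<mu> \<le> 1\<close>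
        by (intro add_mono mult_right_mono mult_left_mono) auto
      finally show ?thesis by (simp add: g_def algebra_simps)
    qed
    show "g integrable_on {q..b}" using g by blast
  qed (fact assms derivf derivf' lb)+
  also have "\<dots> \<le> (4 * M + V) * d / (m * \<omega>)"
  proof (rule divide_right_mono)
    have "d * integral {q..b} (\<lambda>x. norm (u' x)) \<le> d * V"
      using u'(2) by (intro mult_left_mono) (simp_all add: d_def)
    moreover have "0 \<le> M * (b - a) powr (\<mu> - 1)"
      using \<open>0 \<le> M\<close> by simp
    ultimately show "3 * (d * M) + integral {q..b} g \<le> (4 * M + V) * d"
      using g by (simp add: integral_unique algebra_simps)
  qed (use \<open>0 < m\<close> \<open>0 < \<omega>\<close> in simp)
  finally show ?thesis by (simp add: A_def d_def)
qed

section \<open>Splitting at distance \<open>1 / \<omega>\<close> from the singularity\<close>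

theorem theorem1p10:
  fixes p1 p2 \<mu> :: real and I :: "real set"
    and U u :: "real \<Rightarrow> complex" and \<psi> :: "real \<Rightarrow> real"
  assumes "p1 < p2"
    and "open I" "is_interval I" "{p1..p2} \<subseteq> I"
    and "0 < \<mu>" "\<mu> \<le> 1"
    and "continuous_on {p1..p2} u"
    and "\<forall>p\<in>{p1<..<p2}. u differentiable (at p)"
    and "(\<lambda>p. vector_derivative u (at p)) absolutely_integrable_on {p1<..<p2}"
    and "\<mu> \<noteq> 1 \<longrightarrow> u p1 \<noteq> 0"
    and "\<forall>p\<in>{p1<..p2}. U p = complex_of_real ((p - p1) powr (\<mu> - 1)) * u p"
    and "\<psi> C2_differentiable_on I"
    and "\<forall>p\<in>{p1..p2}. deriv \<psi> p \<noteq> 0"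
    and "mono_on {p1..p2} (deriv \<psi>) \<or> antimono_on {p1..p2} (deriv \<psi>)"
  shows "\<forall>\<omega>>0. norm (LINT p:{p1<..p2}|lebesgue.
            U p * exp (\<i> * complex_of_real \<omega> * complex_of_real (\<psi> p)))
         \<le> Cc p1 p2 \<mu> u \<psi> * \<omega> powr (- \<mu>)"
proof (intro allI impI)
  fix \<omega> :: real assume \<omega>: "0 < \<omega>"
  define M where "M = Linf_norm {p1<..<p2} u"
  define u' where "u' = (\<lambda>p. vector_derivative u (at p))"
  define V where "V = L1_norm {p1<..<p2} u'"
  define m where "m = (INF p\<in>{p1..p2}. \<bar>deriv \<psi> p\<bar>)"
  define E where "E = (\<lambda>p. exp (\<i> * complex_of_real \<omega> * complex_of_real (\<psi> p)))"
  \<comment> \<open>Grouping \<open>u p * E p\<close> makes it the continuous factor of the singular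
    estimate; since \<open>E\<close> has modulus 1, the bound \<open>M\<close> for \<open>u\<close>
    carries over.\<close>
  define G where "G = (\<lambda>p. complex_of_real ((p - p1) powr (\<mu> - 1)) * (u p * E p))"
  have u_le: "norm (u p) \<le> M" if "p \<in> {p1..p2}" for p
    unfolding M_def using norm_le_Linf_norm assms(1,7) that by blast
  have "0 \<le> M"
    using order_trans[OF norm_ge_zero u_le[of p1]] \<open>p1 < p2\<close> by simp
  have derivu: "(u has_vector_derivative u' p) (at p)" if "p \<in> {p1<..<p2}" for p
    using assms(8) that by (simp add: u'_def vector_derivative_works)
  have "(\<lambda>p. norm (u' p)) absolutely_integrable_on {p1<..<p2}"
    unfolding u'_def using assms(9) by (rule set_integrable_norm)
  then have V: "((\<lambda>p. norm (u' p)) has_integral V) {p1..p2}"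
    unfolding V_def L1_norm_def has_integral_Icc_iff_Ioo by (rule has_integral_set_lebesgue)
  then have "0 \<le> V"
    by (rule has_integral_nonneg) simp
  have C1: "\<psi> C1_differentiable_on I" "deriv \<psi> C1_differentiable_on I"
    using assms(12) by (simp_all add: C2_differentiable_on_def)
  obtain \<psi>'' where "\<forall>p\<in>I. (deriv \<psi> has_vector_derivative \<psi>'' p) (at p)"
    using C1(2) unfolding C1_differentiable_on_def by (elim exE conjE)
  then have \<psi>'': "(deriv \<psi> has_real_derivative \<psi>'' p) (at p)" if "p \<in> I" for p
    using that by (simp add: has_real_derivative_iff_has_vector_derivative)
  obtain D where "\<forall>p\<in>I. (\<psi> has_vector_derivative D p) (at p)"
    using C1(1) unfolding C1_differentiable_on_def by (elim exE conjE)
  then have "(\<psi> has_real_derivative D p) (at p)" if "p \<in> I" for p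
    using that by (simp add: has_real_derivative_iff_has_vector_derivative)
  then have \<psi>': "(\<psi> has_real_derivative deriv \<psi> p) (at p)" if "p \<in> I" for p
    using that DERIV_imp_deriv by fastforce
  have cont\<psi>: "continuous_on {p1..p2} \<psi>" and cont\<psi>': "continuous_on {p1..p2} (deriv \<psi>)"
    using assms(4) \<psi>' \<psi>'' by (auto intro!: continuous_at_imp_continuous_on dest: DERIV_isCont)
  \<comment> \<open>The infimum is attained by compactness, so the nonvanishing of
    \<open>deriv \<psi>\<close> gives \<open>0 < m\<close>.\<close>
  obtain p0 where p0: "p0 \<in> {p1..p2}" "\<And>p. p \<in> {p1..p2} \<Longrightarrow> \<bar>deriv \<psi> p0\<bar> \<le> \<bar>deriv \<psi> p\<bar>"
    using continuous_attains_inf[of "{p1..p2}" "\<lambda>p. \<bar>deriv \<psi> p\<bar>"]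
      continuous_on_rabs[OF cont\<psi>'] \<open>p1 < p2\<close>
    by auto
  have m_eq: "m = \<bar>deriv \<psi> p0\<bar>"
    unfolding m_def using p0 by (intro cInf_eq_minimum) auto
  have "0 < m"
    using m_eq p0(1) assms(13) by simp
  have lb: "m \<le> \<bar>deriv \<psi> p\<bar>" if "p \<in> {p1..p2}" for p
    using p0(2)[OF that] by (simp add: m_eq)
  have Cc: "Cc p1 p2 \<mu> u \<psi> = 1 / \<mu> * M + (4 * M + V) * inverse m"
    by (simp add: Cc_def M_def V_def m_def u'_def)
  have contuE: "continuous_on {p1..p2} (\<lambda>p. u p * E p)"
    unfolding E_def by (intro continuous_intros cont\<psi> assms(7))
  have uE_le: "norm (u p * E p) \<le> M" if "p \<in> {p1..p2}" for p
    using u_le[OF that] by (simp add: E_def norm_mult mult.assoc flip: of_real_mult)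
  have head: "G absolutely_integrable_on {p1<..q}"
      "norm (integral {p1<..q} G) \<le> 1 / \<mu> * M * (q - p1) powr \<mu>" if "p1 \<le> q" "q \<le> p2" for q
  proof -
    have "continuous_on {p1..q} (\<lambda>p. u p * E p)"
      using contuE by (rule continuous_on_subset) (use that in auto)
    moreover have "norm (u p * E p) \<le> M" if "p \<in> {p1..q}" for p
      using uE_le that \<open>q \<le> p2\<close> by simp
    ultimately show "G absolutely_integrable_on {p1<..q}"
        "norm (integral {p1<..q} G) \<le> 1 / \<mu> * M * (q - p1) powr \<mu>"
      unfolding G_def using powr_singular_integral_bound[OF \<open>p1 \<le> q\<close> \<open>0 < \<mu>\<close>] by blast+
  qed
  \<comment> \<open>The formula for \<open>U\<close> is given only on \<open>{p1<..p2}\<close>, so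
    \<open>U\<close> is replaced there. Absolute integrability of \<open>G\<close> then identifies
    the Lebesgue integral with the gauge integral used in the estimates.\<close>
  have LINT: "(LINT p:{p1<..p2}|lebesgue. U p * E p) = integral {p1<..p2} G"
  proof -
    have "(LINT p:{p1<..p2}|lebesgue. U p * E p) = (LINT p:{p1<..p2}|lebesgue. G p)"
      by (rule set_lebesgue_integral_cong) (use assms(11) in \<open>auto simp: G_def mult.assoc\<close>)
    then show ?thesis
      using set_lebesgue_integral_eq_integral(2)[OF head(1)[of p2]] \<open>p1 < p2\<close> by simp
  qed
  have "norm (integral {p1<..p2} G) \<le> (1 / \<mu> * M + (4 * M + V) * inverse m) * \<omega> powr (- \<mu>)"
  proof (cases "p2 \<le> p1 + 1 / \<omega>")
    case True
    have "norm (integral {p1<..p2} G) \<le> 1 / \<mu> * M * (p2 - p1) powr \<mu>"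
      using head(2)[of p2] \<open>p1 < p2\<close> by simp
    \<comment> \<open>The whole interval has length at most \<open>1 / \<omega>\<close>, so its
      power is already bounded by \<open>\<omega> powr (- \<mu>)\<close>.\<close>
    also have "\<dots> \<le> 1 / \<mu> * M * (1 / \<omega>) powr \<mu>"
      using True \<open>p1 < p2\<close> \<open>0 \<le> M\<close> \<open>0 < \<mu>\<close> by (intro mult_left_mono powr_mono2) auto
    also have "\<dots> = 1 / \<mu> * M * \<omega> powr (- \<mu>)"
      using \<omega> by (simp add: powr_divide powr_minus_divide)
    also have "\<dots> \<le> (1 / \<mu> * M + (4 * M + V) * inverse m) * \<omega> powr (- \<mu>)"
      using \<open>0 \<le> M\<close> \<open>0 \<le> V\<close> \<open>0 < m\<close> by (intro mult_right_mono) auto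
    finally show ?thesis .
  next
    case False
    define q where "q = p1 + 1 / \<omega>"
    have q: "p1 < q" "q < p2"
      using False \<omega> by (auto simp: q_def)
    have sub: "{q..p2} \<subseteq> {p1..p2}" "{q<..<p2} \<subseteq> {p1<..<p2}"
      using q by auto
    have V': "(\<lambda>p. norm (u' p)) integrable_on {q..p2}"
      using V sub(1) by (blast intro: integrable_on_subinterval)
    have "integral {q..p2} (\<lambda>p. norm (u' p)) \<le> integral {p1..p2} (\<lambda>p. norm (u' p))"
      using V V' sub by (intro integral_subset_le) auto
    then have V_le: "integral {q..p2} (\<lambda>p. norm (u' p)) \<le> V"
      using V by (simp add: integral_unique)
    have mono: "mono_on {q..p2} (deriv \<psi>) \<or> antimono_on {q..p2} (deriv \<psi>)"
      using assms(14) sub by (meson monotone_on_subset)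
    have "norm (integral {q..p2} G) \<le> (4 * M + V) * (q - p1) powr (\<mu> - 1) / (m * \<omega>)"
      unfolding G_def E_def mult.assoc[symmetric]
      by (rule powr_singular_oscillatory_tail_bound[OF q(1) _ \<open>\<mu> \<le> 1\<close> \<open>0 < m\<close> \<omega> _ derivu u_le
            V' V_le _ \<psi>' _ \<psi>'' lb mono])
        (use q sub assms(4) in
          \<open>auto intro: continuous_on_subset[OF assms(7)] continuous_on_subset[OF cont\<psi>]
            continuous_on_subset[OF cont\<psi>']\<close>)
    also have "\<dots> = (4 * M + V) * inverse m * ((q - p1) powr (\<mu> - 1) / \<omega>)"
      by (simp add: field_simps)
    \<comment> \<open>With \<open>q - p1 = 1 / \<omega>\<close>, the weight at \<open>q\<close> is
      \<open>\<omega> powr (1 - \<mu>)\<close>; dividing by \<open>\<omega>\<close> gives the same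
      power as the singular part.\<close>
    also have "(q - p1) powr (\<mu> - 1) / \<omega> = \<omega> powr (- \<mu>)"
      using \<omega> by (simp add: q_def powr_divide powr_minus_divide powr_diff)
    finally have tail: "norm (integral {q..p2} G) \<le> (4 * M + V) * inverse m * \<omega> powr (- \<mu>)" .
    have "(q - p1) powr \<mu> = \<omega> powr (- \<mu>)"
      using \<omega> by (simp add: q_def powr_divide powr_minus_divide)
    then have head': "norm (integral {p1<..q} G) \<le> 1 / \<mu> * M * \<omega> powr (- \<mu>)"
      using head(2)[of q] q by simp
    have "G integrable_on {p1<..q}"
      using head(1)[of q] q by (simp add: set_lebesgue_integral_eq_integral)
    moreover have "G integrable_on {q..p2}"
    proof -
      have "G absolutely_integrable_on {q..p2}"
        using head(1)[of p2] q by (auto intro: set_integrable_subset)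
      then show ?thesis by (rule set_lebesgue_integral_eq_integral)
    qed
    \<comment> \<open>The two pieces share only the point \<open>q\<close>, which is
      negligible.\<close>
    moreover have "{p1<..p2} = {p1<..q} \<union> {q..p2}" "{p1<..q} \<inter> {q..p2} = {q}"
      using q by auto
    ultimately have "integral {p1<..p2} G = integral {p1<..q} G + integral {q..p2} G"
      by (simp add: integral_Un)
    then show ?thesis
      using norm_triangle_ineq[of "integral {p1<..q} G" "integral {q..p2} G"] head' tail
      by (simp add: distrib_right)
  qed
  then show "norm (LINT p:{p1<..p2}|lebesgue.
            U p * exp (\<i> * complex_of_real \<omega> * complex_of_real (\<psi> p)))
         \<le> Cc p1 p2 \<mu> u \<psi> * \<omega> powr (- \<mu>)"
    using LINT by (simp add: Cc E_def)
qed

end
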